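(* Let $L$ be a fixed finite list of fixed graphs, none of which is a forest, let $d$ be the minimum degeneracy of the graphs in $L$, and let $\mathcal{P}$ be the property of containing (as a subgraph) a graph in $L$. Then, in the semi-random graph process: (1) there exists a constant $\alpha>0$ such that for all sufficiently large $n$ and every strategy $\mathcal{S}$, $\Pr\big(G^{\mathcal{S}}_{\alpha n^{(d-1)/d}}\in\mathcal{P}\big)\le 1/2$; (2) for any constant $\beta>0$ there exists a constant $\delta=\delta(\beta)>0$ such that for all sufficiently large $n$ there is a strategy $\mathcal{S}$ with $\Pr\big(G^{\mathcal{S}}_{\beta n^{(d-1)/d}}\in\mathcal{P}\big)\ge\delta$.
   Context: Semi-random graph process: start with the empty graph on $[n]$; in each step a vertex $u_t$ (square) is drawn independently and uniformly at random from $[n]$, the player adaptively chooses a vertex $v_t$ (circle), and the edge $u_tv_t$ is added. $G^{\mathcal{S}}_t$ is the graph after $t$ steps under strategy $\mathcal{S}$. A graph is $d$-degenerate if every subgraph has a vertex of degree at most $d$; its degeneracy is the least such $d$. *)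

theory Defs
  imports "HOL-Probability.Probability"
begin

datatype 'a ugraph = Graph (verts: "'a set") (edges: "'a set set")

definition simple_graph :: "'a ugraph \<Rightarrow> bool" where
  "simple_graph G \<longleftrightarrow> finite (verts G) \<and> (\<forall>e\<in>edges G. e \<subseteq> verts G \<and> card e = 2)"

definition subgraph :: "'a ugraph \<Rightarrow> 'a ugraph \<Rightarrow> bool" where
  "subgraph H G \<longleftrightarrow> simple_graph H \<and> verts H \<subseteq> verts G \<and> edges H \<subseteq> edges G"

definition degree :: "'a ugraph \<Rightarrow> 'a \<Rightarrow> nat" where
  "degree G v = card {e \<in> edges G. v \<in> e}"

(* A cycle is given by the list of its distinct vertices; the closing edge joins the
   last vertex to the first one. *)
definition is_cycle :: "'a ugraph \<Rightarrow> 'a list \<Rightarrow> bool" where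
  "is_cycle G vs \<longleftrightarrow> 3 \<le> length vs \<and> distinct vs \<and>
     (\<forall>i<length vs. {vs ! i, vs ! (Suc i mod length vs)} \<in> edges G)"

definition forest :: "'a ugraph \<Rightarrow> bool" where
  "forest G \<longleftrightarrow> simple_graph G \<and> (\<nexists>vs. is_cycle G vs)"

(* Subgraphs without vertices have to be excluded: they have no vertex of any degree. *)
definition degenerate :: "nat \<Rightarrow> 'a ugraph \<Rightarrow> bool" where
  "degenerate d G \<longleftrightarrow>
     (\<forall>H. subgraph H G \<and> verts H \<noteq> {} \<longrightarrow> (\<exists>v\<in>verts H. degree H v \<le> d))"

definition degeneracy :: "'a ugraph \<Rightarrow> nat" where
  "degeneracy G = (LEAST d. degenerate d G)"

(* G contains a (not necessarily induced) copy of H. *)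
definition contains_copy :: "'b ugraph \<Rightarrow> 'a ugraph \<Rightarrow> bool" where
  "contains_copy G H \<longleftrightarrow>
     (\<exists>f. inj_on f (verts H) \<and> f ` verts H \<subseteq> verts G \<and> (\<forall>e\<in>edges H. f ` e \<in> edges G))"

(* The pairs (square, circle) of the steps played so far, most recent step first. *)
type_synonym history = "(nat \<times> nat) list"

(* Given the history and the current square, the player picks the circle according to a
   probability distribution; deterministic strategies are the ones using return_pmf. *)
type_synonym strategy = "history \<Rightarrow> nat \<Rightarrow> nat pmf"

definition valid_strategy :: "nat \<Rightarrow> strategy \<Rightarrow> bool" where
  "valid_strategy n S \<longleftrightarrow>
     (\<forall>h u. set h \<subseteq> {1..n} \<times> {1..n} \<and> u \<in> {1..n} \<longrightarrow> set_pmf (S h u) \<subseteq> {1..n})"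

(* Distribution of the history after t steps; meaningful for n > 0 only. *)
primrec semi_random_process :: "nat \<Rightarrow> strategy \<Rightarrow> nat \<Rightarrow> history pmf" where
  "semi_random_process n S 0 = return_pmf []"
| "semi_random_process n S (Suc t) =
     bind_pmf (semi_random_process n S t) (\<lambda>h.
     bind_pmf (pmf_of_set {1..n}) (\<lambda>u.
     bind_pmf (S h u) (\<lambda>v.
     return_pmf ((u, v) # h))))"

(* The player may choose v = u or repeat an edge.  Loops are dropped and parallel edges are
   merged, which does not affect containment of simple graphs. *)
definition history_graph :: "nat \<Rightarrow> history \<Rightarrow> nat ugraph" where
  "history_graph n h = Graph {1..n} {{u, v} | u v. (u, v) \<in> set h \<and> u \<noteq> v}"

definition semi_random_graph :: "nat \<Rightarrow> strategy \<Rightarrow> nat \<Rightarrow> nat ugraph pmf" where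
  "semi_random_graph n S t = map_pmf (history_graph n) (semi_random_process n S t)"

end

(* Upper bound. Orient every edge from its square to its circle. Call a step an exposure of p if
   its square is reachable from p by boundedly many edges. If no vertex is exposed d times, then
   out-degrees are below d, so the sets of points reachable from p have bounded size K; hence a
   given vertex is exposed d times within t steps with probability at most (t K / n)^d, and a union
   bound gives n (t K / n)^d, which is small for t = alpha n^((d-1)/d). Conversely, a copy of a
   graph of minimum degree at least d forces some p to be exposed d times: inside the copy there
   are p and x on a common closed walk such that the degree of x is at most the exposure of p.

   Lower bound. Embed the vertices of a d-degenerate graph one at a time in an order in which each
   has at most d earlier neighbours. To find a common neighbour of z_1, ..., z_d, play z_1 as the
   circle for s steps, then z_2, and so on; the vertices hit in all phases number about
   n (s / n)^d, which is of constant order for s of order n^((d-1)/d). *)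

theory Submission
  imports Defs
begin

section \<open>Upper bound\<close>

primrec out_ball :: "nat \<Rightarrow> history \<Rightarrow> nat \<Rightarrow> nat set" where
  "out_ball 0 h p = {p}"
| "out_ball (Suc N) h p = out_ball N h p \<union> set h `` out_ball N h p"

lemma finite_out_ball: "finite (out_ball N h p)"
  by (induction N) (auto simp: finite_Image)

lemma out_ball_mono: "M \<le> N \<Longrightarrow> out_ball M h p \<subseteq> out_ball N h p"
  by (induction N) (auto simp: le_Suc_eq)

lemma relpow_subset_out_ball: "(p, y) \<in> set h ^^ i \<Longrightarrow> y \<in> out_ball i h p"
  by (induction i arbitrary: y) auto

text \<open>Each extra unit of radius keeps the old points and adds at most \<open>D\<close>
  successors of each, a factor of at most \<open>Suc D\<close>.\<close>

lemma card_out_ball_le: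
  assumes "\<And>x. card (set h `` {x}) \<le> D"
  shows "card (out_ball N h p) \<le> Suc D ^ N"
proof (induction N)
  case (Suc N)
  have "card (set h `` out_ball N h p) = card (\<Union>b\<in>out_ball N h p. set h `` {b})"
    by (rule arg_cong[where f = card]) auto
  also have "\<dots> \<le> (\<Sum>b\<in>out_ball N h p. card (set h `` {b}))"
    by (rule card_UN_le[OF finite_out_ball])
  also have "\<dots> \<le> (\<Sum>b\<in>out_ball N h p. D)"
    by (rule sum_mono) (rule assms)
  finally have "card (set h `` out_ball N h p) \<le> card (out_ball N h p) * D" by simp
  then have "card (out_ball (Suc N) h p) \<le> card (out_ball N h p) + card (out_ball N h p) * D"
    using card_Un_le[of "out_ball N h p" "set h `` out_ball N h p"] by simp
  also have "\<dots> = card (out_ball N h p) * Suc D" by simp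
  also have "\<dots> \<le> Suc D ^ N * Suc D" using Suc.IH by (rule mult_right_mono) simp
  finally show ?case by (simp add: mult.commute)
qed simp

text \<open>A reachable point is reached in at most as many steps as the relation has pairs, and
  inside \<open>U\<close> these are at most \<open>card U ^ 2\<close>. So a radius depending only on
  \<open>card U\<close> captures all reachability inside \<open>U\<close>.\<close>

lemma rtrancl_subset_out_ball:
  assumes "finite U" "card U ^ 2 \<le> N" "(p, y) \<in> (set h \<inter> U \<times> U)\<^sup>*"
  shows "y \<in> out_ball N h p"
proof -
  let ?R = "set h \<inter> U \<times> U"
  have "card ?R \<le> card (U \<times> U)" using assms(1) by (intro card_mono) auto
  then have R: "card ?R \<le> N"
    using assms(2) by (simp add: card_cartesian_product power2_eq_square)
  obtain i where i: "i \<le> card ?R" "(p, y) \<in> ?R ^^ i"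
    using assms(3) by (auto simp: rtrancl_finite_eq_relpow)
  have "?R ^^ i \<subseteq> set h ^^ i" by (induction i) (auto intro: relcomp_mono)
  then have "(p, y) \<in> set h ^^ i" using i(2) by blast
  then show ?thesis
    using relpow_subset_out_ball out_ball_mono[of i N h p] i(1) R by fastforce
qed

text \<open>Balls with more than \<open>K\<close> points do not count; this makes every step an exposure of \<open>p\<close>
  with probability at most \<open>K / n\<close>.\<close>

primrec exposure :: "nat \<Rightarrow> nat \<Rightarrow> history \<Rightarrow> nat \<Rightarrow> nat" where
  "exposure N K [] p = 0"
| "exposure N K (e # h) p =
     exposure N K h p + of_bool (fst e \<in> out_ball N h p \<and> card (out_ball N h p) \<le> K)"

lemma exposure_Cons_ge: "exposure N K h p \<le> exposure N K (e # h) p"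
  by simp

section \<open>Degrees inside a vertex set against exposure\<close>

text \<open>Parallel edges count once; a loop at \<open>x\<close> counts \<open>x\<close> itself,
  which only increases the number that bounds degrees in a copy.\<close>

definition degree_in :: "history \<Rightarrow> nat set \<Rightarrow> nat \<Rightarrow> nat" where
  "degree_in h U x = card {y \<in> U. (x, y) \<in> set h \<or> (y, x) \<in> set h}"

lemma degree_in_Cons_le:
  assumes "finite U"
  shows "degree_in ((u, w) # h) U x \<le> Suc (degree_in h U x)"
proof -
  let ?D = "{y \<in> U. (x, y) \<in> set h \<or> (y, x) \<in> set h}"
  have "{y \<in> U. (x, y) \<in> set ((u, w) # h) \<or> (y, x) \<in> set ((u, w) # h)}
      \<subseteq> insert (if x = u then w else u) ?D"
    by auto
  then have "degree_in ((u, w) # h) U x \<le> card (insert (if x = u then w else u) ?D)"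
    unfolding degree_in_def using assms by (intro card_mono) auto
  also have "\<dots> \<le> Suc (card ?D)" using assms by (simp add: card_insert_if)
  finally show ?thesis by (simp add: degree_in_def)
qed

lemma degree_in_Cons_eq:
  "u \<notin> U \<or> w \<notin> U \<or> x \<notin> {u, w} \<Longrightarrow> x \<in> U \<Longrightarrow>
    degree_in ((u, w) # h) U x = degree_in h U x"
  unfolding degree_in_def by (rule arg_cong[where f = card]) auto

text \<open>The invariant for the upper bound. The mutual reachability of \<open>p\<close> and \<open>x\<close> is what lets it
  survive a new edge inside \<open>U\<close>.\<close>

definition controlled :: "nat \<Rightarrow> nat \<Rightarrow> history \<Rightarrow> nat set \<Rightarrow> nat \<Rightarrow> bool" where
  "controlled N K h U v \<longleftrightarrow> (\<exists>p\<in>U. \<exists>x\<in>U.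
     (p, v) \<in> (set h \<inter> U \<times> U)\<^sup>* \<and> (p, x) \<in> (set h \<inter> U \<times> U)\<^sup>* \<and>
     (x, p) \<in> (set h \<inter> U \<times> U)\<^sup>* \<and> degree_in h U x \<le> exposure N K h p)"

text \<open>A witness pair fails only if the new edge raises the degree of \<open>x\<close> without
  exposing \<open>p\<close>. Then the edge enters \<open>x\<close> at its circle \<open>w\<close>,
  from a point that \<open>p\<close> does not reach, and the pair of \<open>u\<close> takes
  over.\<close>

lemma controlled_Cons:
  assumes U: "finite U" "card U ^ 2 \<le> N"
    and small: "\<And>p. card (out_ball N h p) \<le> K"
    and IH: "\<And>v. v \<in> U \<Longrightarrow> controlled N K h U v"
    and v: "v \<in> U"
  shows "controlled N K ((u, w) # h) U v"
proof -
  let ?R = "(set h \<inter> U \<times> U)\<^sup>*" and ?R' = "(set ((u, w) # h) \<inter> U \<times> U)\<^sup>*"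
  have sub: "?R \<subseteq> ?R'" by (rule rtrancl_mono) auto
  obtain p x where px: "p \<in> U" "x \<in> U" "(p, v) \<in> ?R" "(p, x) \<in> ?R" "(x, p) \<in> ?R"
    "degree_in h U x \<le> exposure N K h p"
    using IH[OF v] unfolding controlled_def by blast
  \<comment> \<open>Reachability within \<open>U\<close> puts \<open>u\<close> into the ball of
    \<open>q\<close>, and \<open>small\<close> keeps that ball below the cutoff, so the step counts
    for \<open>q\<close>.\<close>
  have inc: "exposure N K ((u, w) # h) q = Suc (exposure N K h q)" if "(q, u) \<in> ?R" for q
    using rtrancl_subset_out_ball[OF U that] small[of q] by simp
  \<comment> \<open>If \<open>x = u\<close>, then \<open>p\<close> reaches \<open>u\<close> because
    it reaches \<open>x\<close>; so only \<open>x = w\<close> is left for the third case.\<close>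
  consider "u \<notin> U \<or> w \<notin> U \<or> x \<notin> {u, w}" | "(p, u) \<in> ?R" | "u \<in> U" "w \<in> U" "x = w"
    using px by auto
  then show ?thesis
  proof cases
    case 1
    then have "degree_in ((u, w) # h) U x \<le> exposure N K ((u, w) # h) p"
      using degree_in_Cons_eq[of u U w x h] px exposure_Cons_ge[of N K h p "(u, w)"] by linarith
    then show ?thesis unfolding controlled_def using px sub by blast
  next
    case 2
    then have "degree_in ((u, w) # h) U x \<le> exposure N K ((u, w) # h) p"
      using degree_in_Cons_le[OF U(1), of u w h x] px inc[OF 2] by linarith
    then show ?thesis unfolding controlled_def using px sub by blast
  next
    \<comment> \<open>The witness for \<open>u\<close> reaches \<open>v\<close> along the new edge and is exposed by it.\<close>
    case 3
    obtain q y where qy: "q \<in> U" "y \<in> U" "(q, u) \<in> ?R" "(q, y) \<in> ?R" "(y, q) \<in> ?R"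
      "degree_in h U y \<le> exposure N K h q"
      using IH[OF 3(1)] unfolding controlled_def by blast
    have "(u, w) \<in> ?R'" using 3 by auto
    then have "(q, v) \<in> ?R'"
      using sub qy(3) px(3,5) \<open>x = w\<close> by (meson rtrancl_trans subsetD)
    moreover have "degree_in ((u, w) # h) U y \<le> exposure N K ((u, w) # h) q"
      using degree_in_Cons_le[OF U(1), of u w h y] qy inc[OF qy(3)] by linarith
    ultimately show ?thesis unfolding controlled_def using qy sub by blast
  qed
qed

text \<open>As long as no point is exposed \<open>d\<close> times, out-degrees stay below
  \<open>d\<close> and balls have at most \<open>d ^ N\<close> points, which explains the cutoff.
  Then both invariants survive one more step, whether or not that step brings a \<open>d\<close>-th
  exposure.\<close>

lemma exposed_or_controlled:
  assumes "d > 0" "set h \<subseteq> S \<times> S"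
  shows "(\<exists>p\<in>S. d \<le> exposure N (d ^ N) h p) \<or>
    ((\<forall>x. card (set h `` {x}) \<le> exposure N (d ^ N) h x) \<and>
     (\<forall>U v. finite U \<longrightarrow> U \<subseteq> S \<longrightarrow> card U ^ 2 \<le> N \<longrightarrow> v \<in> U \<longrightarrow> controlled N (d ^ N) h U v))"
  using assms(2)
proof (induction h)
  case Nil
  then show ?case by (auto simp: controlled_def degree_in_def)
next
  case (Cons e h)
  obtain u w where e: "e = (u, w)" by (cases e)
  let ?X = "exposure N (d ^ N)"
  have IH: "(\<exists>p\<in>S. d \<le> ?X h p) \<or> ((\<forall>x. card (set h `` {x}) \<le> ?X h x) \<and>
      (\<forall>U v. finite U \<longrightarrow> U \<subseteq> S \<longrightarrow> card U ^ 2 \<le> N \<longrightarrow> v \<in> U \<longrightarrow> controlled N (d ^ N) h U v))"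
    using Cons.IH Cons.prems by simp
  show ?case
  proof (cases "\<exists>p\<in>S. d \<le> ?X h p")
    case True
    then show ?thesis using exposure_Cons_ge by (meson le_trans)
  next
    case False
    have C: "(\<forall>x. card (set h `` {x}) \<le> ?X h x) \<and>
      (\<forall>U v. finite U \<longrightarrow> U \<subseteq> S \<longrightarrow> card U ^ 2 \<le> N \<longrightarrow> v \<in> U \<longrightarrow> controlled N (d ^ N) h U v)"
      using IH
    proof
      assume "\<exists>p\<in>S. d \<le> ?X h p"
      with False show ?thesis by (rule notE)
    qed
    have controlled: "\<And>p. p \<in> S \<Longrightarrow> ?X h p < d" "\<And>x. card (set h `` {x}) \<le> ?X h x"
      "\<And>U v. finite U \<Longrightarrow> U \<subseteq> S \<Longrightarrow> card U ^ 2 \<le> N \<Longrightarrow> v \<in> U \<Longrightarrow> controlled N (d ^ N) h U v"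
    proof -
      show "?X h p < d" if "p \<in> S" for p using False that by (meson not_le)
    qed (use C in simp_all)
    have "card (set h `` {x}) \<le> d - 1" for x
    proof (cases "x \<in> S")
      case True
      then show ?thesis using controlled(1)[OF True] controlled(2)[of x] by linarith
    next
      case False
      then have "set h `` {x} = {}" using Cons.prems by auto
      then show ?thesis by (metis card.empty le0)
    qed
    then have small: "card (out_ball N h p) \<le> d ^ N" for p
      using card_out_ball_le[of h "d - 1" N p] assms(1) by simp
    have deg: "card (set (e # h) `` {x}) \<le> ?X (e # h) x" for x
    proof (cases "x = u")
      case True
      \<comment> \<open>The square lies in its own ball, so playing it raises its exposure along
        with its out-degree.\<close>
      have "u \<in> out_ball N h u" using out_ball_mono[of 0 N h u] by simp
      then have "?X (e # h) x = Suc (?X h x)" using small[of x] by (simp add: True e)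
      moreover have "set (e # h) `` {x} = insert w (set h `` {x})" using True e by auto
      then have "card (set (e # h) `` {x}) \<le> Suc (card (set h `` {x}))"
        by (simp add: card_insert_if finite_Image)
      ultimately show ?thesis using controlled(2)[of x] by linarith
    next
      case False
      then have "set (e # h) `` {x} = set h `` {x}" using e by auto
      then show ?thesis using controlled(2)[of x] exposure_Cons_ge[of N "d ^ N" h x e] by (metis le_trans)
    qed
    have ctrl: "controlled N (d ^ N) (e # h) U v"
      if "finite U" "U \<subseteq> S" "card U ^ 2 \<le> N" "v \<in> U" for U v
      unfolding e using that by (intro controlled_Cons small controlled(3))
    show ?thesis by (intro disjI2 conjI allI impI deg ctrl)
  qed
qed

section \<open>Copies force exposure\<close>

text \<open>Distinct edges at \<open>v\<close> have distinct images \<open>{f v, y}\<close>, and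
  each such \<open>y\<close> is counted by \<open>degree_in\<close>, whichever endpoint was the
  square.\<close>

lemma degree_le_degree_in:
  assumes H: "simple_graph H" and f: "inj_on f (verts H)"
    and e: "\<And>e. e \<in> edges H \<Longrightarrow> f ` e \<in> edges (history_graph n h)"
    and v: "v \<in> verts H"
  shows "Defs.degree H v \<le> degree_in h (f ` verts H) (f v)"
proof -
  let ?D = "{y \<in> f ` verts H. (f v, y) \<in> set h \<or> (y, f v) \<in> set h}"
  have fin: "finite ?D" using H by (auto simp: simple_graph_def)
  have sub: "e \<subseteq> verts H" if "e \<in> edges H" for e using H that by (auto simp: simple_graph_def)
  have "(`) f ` {e \<in> edges H. v \<in> e} \<subseteq> (\<lambda>y. {f v, y}) ` ?D"
  proof (rule image_subsetI)
    fix e' assume "e' \<in> {e \<in> edges H. v \<in> e}"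
    then have e': "e' \<in> edges H" "v \<in> e'" by auto
    obtain a b where ab: "f ` e' = {a, b}" "(a, b) \<in> set h"
      using e[OF e'(1)] by (auto simp: history_graph_def)
    have "f v \<in> {a, b}" "{a, b} \<subseteq> f ` verts H"
      using ab(1) e'(2) sub[OF e'(1)] by (metis imageI, metis image_mono)
    then consider "f v = a" "b \<in> ?D" | "f v = b" "a \<in> ?D" using ab(2) by blast
    then show "f ` e' \<in> (\<lambda>y. {f v, y}) ` ?D"
    proof cases
      case 1
      then show ?thesis using ab(1) by (intro image_eqI[of _ _ b]) simp
    next
      case 2
      then show ?thesis using ab(1) by (intro image_eqI[of _ _ a]) (simp add: insert_commute)
    qed
  qed
  then have "card ((`) f ` {e \<in> edges H. v \<in> e}) \<le> card ((\<lambda>y. {f v, y}) ` ?D)"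
    using fin by (intro card_mono) auto
  also have "\<dots> \<le> card ?D" by (rule card_image_le[OF fin])
  finally have "card ((`) f ` {e \<in> edges H. v \<in> e}) \<le> card ?D" .
  moreover have "inj_on ((`) f) {e \<in> edges H. v \<in> e}"
    by (rule inj_on_subset[OF inj_on_image_Pow[OF f]]) (use sub in auto)
  ultimately show ?thesis unfolding Defs.degree_def degree_in_def by (simp only: card_image)
qed

text \<open>The dichotomy is applied to the image of \<open>H'\<close> alone: if this set is
  controlled, its witness \<open>x\<close> has degree at least \<open>d\<close> there, so the
  witness \<open>p\<close> is exposed at least \<open>d\<close> times.\<close>

lemma exposed_of_copy:
  assumes H: "subgraph H' H" "verts H' \<noteq> {}" "\<And>v. v \<in> verts H' \<Longrightarrow> d \<le> Defs.degree H' v"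
    and d: "d > 0" and fin: "finite (verts H)" and N: "card (verts H) ^ 2 \<le> N"
    and h: "set h \<subseteq> {1..n} \<times> {1..n}" and copy: "contains_copy (history_graph n h) H"
  shows "\<exists>p\<in>{1..n}. d \<le> exposure N (d ^ N) h p"
proof -
  obtain f where f: "inj_on f (verts H)" "f ` verts H \<subseteq> {1..n}"
    "\<And>e. e \<in> edges H \<Longrightarrow> f ` e \<in> edges (history_graph n h)"
    using copy by (auto simp: contains_copy_def history_graph_def)
  have sub: "simple_graph H'" "verts H' \<subseteq> verts H" "edges H' \<subseteq> edges H"
    using H(1) by (auto simp: subgraph_def)
  let ?U = "f ` verts H'"
  have inj: "inj_on f (verts H')" using f(1) sub(2) by (rule inj_on_subset)
  have "card ?U \<le> card (verts H)"
    using card_image[OF inj] card_mono[OF fin sub(2)] by simp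
  then have "card ?U ^ 2 \<le> N" using N power_mono le_trans by blast
  then have U: "finite ?U" "?U \<subseteq> {1..n}" "card ?U ^ 2 \<le> N"
    using finite_subset[OF sub(2) fin] sub(2) f(2) by auto
  obtain v where v: "v \<in> verts H'" using H(2) by (metis all_not_in_conv)
  have "\<exists>p\<in>{1..n}. d \<le> exposure N (d ^ N) h p" if ctrl: "controlled N (d ^ N) h ?U (f v)"
  proof -
    obtain p x where px: "p \<in> ?U" "x \<in> ?U" "degree_in h ?U x \<le> exposure N (d ^ N) h p"
      using ctrl unfolding controlled_def by blast
    obtain y where y: "x = f y" "y \<in> verts H'" using px(2) by (elim imageE)
    have "Defs.degree H' y \<le> degree_in h ?U (f y)"
      by (rule degree_le_degree_in[OF sub(1) inj _ y(2)]) (use f(3) sub(3) in blast)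
    then have "d \<le> degree_in h ?U x" using H(3)[OF y(2)] y(1) by simp
    then show ?thesis using px U(2) by (meson le_trans subsetD)
  qed
  moreover have "(\<exists>p\<in>{1..n}. d \<le> exposure N (d ^ N) h p) \<or> controlled N (d ^ N) h ?U (f v)"
    using exposed_or_controlled[OF d h, of N] U imageI[OF v, of f] by metis
  ultimately show ?thesis by metis
qed

section \<open>Tail bound for the number of exposures\<close>

lemma set_semi_random_process:
  assumes "valid_strategy n S" "n > 0" "h \<in> set_pmf (semi_random_process n S t)"
  shows "set h \<subseteq> {1..n} \<times> {1..n}"
  using assms(3)
proof (induction t arbitrary: h)
  case (Suc t)
  then obtain g u v where h: "h = (u, v) # g" and g: "g \<in> set_pmf (semi_random_process n S t)"
    and u: "u \<in> {1..n}" and v: "v \<in> set_pmf (S g u)"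
    using assms(2) by (auto simp: set_pmf_of_set)
  have "v \<in> {1..n}"
    using assms(1) Suc.IH[OF g] u v unfolding valid_strategy_def by blast
  then show ?case using h u Suc.IH[OF g] by simp
qed simp

lemma measure_bind_pmf:
  "measure_pmf.prob (bind_pmf M f) A = measure_pmf.expectation M (\<lambda>x. measure_pmf.prob (f x) A)"
  unfolding measure_pmf_bind
  by (rule measure_pmf.measure_bind[where N = "count_space UNIV"])
    (auto simp: space_subprob_algebra intro: measure_pmf.subprob_space_axioms)

text \<open>The ball of \<open>p\<close> is fixed before the uniform square is drawn, so under any
  strategy each step is an exposure with conditional probability at most \<open>K / n\<close>. The
  bound counts \<open>j\<close>-sets of steps, as for a binomial tail.\<close>

lemma prob_exposure_ge:
  assumes "n > 0"
  shows "measure_pmf.prob (semi_random_process n S t) {h. j \<le> exposure N K h p}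
    \<le> real (t choose j) * (real K / real n) ^ j"
proof (induction t arbitrary: j)
  case 0
  then show ?case by (cases j) auto
next
  case (Suc t)
  show ?case
  proof (cases j)
    case 0
    then show ?thesis by simp
  next
    case (Suc i)
    let ?M = "semi_random_process n S t"
    let ?E = "\<lambda>j. {h. j \<le> exposure N K h p}"
    let ?step = "\<lambda>h. bind_pmf (pmf_of_set {1..n}) (\<lambda>u. bind_pmf (S h u) (\<lambda>v. return_pmf ((u, v) # h)))"
    \<comment> \<open>With \<open>j\<close> exposures already present the bound is trivial; with
      \<open>i = j - 1\<close> the next square must fall into the ball; with fewer, one step does
      not suffice.\<close>
    have step: "measure_pmf.prob (?step h) (?E j)
        \<le> indicator (?E j) h + real K / real n * indicator (?E i) h" for h
    proof (cases "h \<in> ?E j")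
      case True
      have "measure_pmf.prob (?step h) (?E j) \<le> 1" by (rule measure_pmf.prob_le_1)
      then show ?thesis using True by (auto intro!: add_increasing2)
    next
      case notj: False
      \<comment> \<open>Replacing an oversized ball by the empty set encodes the cutoff.\<close>
      let ?B = "if card (out_ball N h p) \<le> K then out_ball N h p else {}"
      have B: "finite ?B" "card ?B \<le> K" by (auto simp: finite_out_ball)
      show ?thesis
      proof (cases "h \<in> ?E i")
        case True
        have "measure_pmf.prob (?step h) (?E j) \<le> measure_pmf.prob (?step h) {g. fst (hd g) \<in> ?B}"
        proof (rule measure_pmf.finite_measure_mono_AE)
          show "AE g in measure_pmf (?step h). g \<in> ?E j \<longrightarrow> g \<in> {g. fst (hd g) \<in> ?B}"
            using notj by (auto simp: AE_measure_pmf_iff)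
        qed simp
        also have "\<dots> = measure_pmf.prob (map_pmf (\<lambda>g. fst (hd g)) (?step h)) ?B"
          by (simp add: vimage_def)
        also have "map_pmf (\<lambda>g. fst (hd g)) (?step h) = pmf_of_set {1..n}"
          by (simp add: map_bind_pmf bind_return_pmf')
        also have "measure_pmf.prob (pmf_of_set {1..n}) ?B = card ({1..n} \<inter> ?B) / card {1..n}"
          using assms by (intro measure_pmf_of_set) auto
        also have "\<dots> \<le> real K / real n"
        proof -
          have "card ({1..n} \<inter> ?B) \<le> card ?B" using B(1) by (intro card_mono) auto
          then show ?thesis using B(2) by (simp add: divide_right_mono)
        qed
        finally show ?thesis using True notj by simp
      next
        case False
        have "measure_pmf.prob (?step h) (?E j) = 0"
          using False Suc by (auto simp: measure_pmf_zero_iff disjoint_iff of_bool_def split: if_splits)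
        then show ?thesis using False notj by simp
      qed
    qed
    have "measure_pmf.prob (semi_random_process n S (Suc t)) (?E j)
        = measure_pmf.expectation ?M (\<lambda>h. measure_pmf.prob (?step h) (?E j))"
      unfolding semi_random_process.simps
      by (rule measure_bind_pmf)
    also have "\<dots> \<le> measure_pmf.expectation ?M
        (\<lambda>h. indicator (?E j) h + real K / real n * indicator (?E i) h)"
    proof (rule integral_mono)
      show "integrable ?M (\<lambda>h. measure_pmf.prob (?step h) (?E j))"
        by (rule measure_pmf.integrable_const_bound[where B = 1]) auto
      show "integrable ?M (\<lambda>h. indicator (?E j) h + real K / real n * indicator (?E i) h)"
        by (intro Bochner_Integration.integrable_add integrable_mult_right integrable_real_indicator) (auto simp: less_top[symmetric])
    qed (rule step)
    also have "\<dots> = measure_pmf.prob ?M (?E j) + real K / real n * measure_pmf.prob ?M (?E i)"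
    proof (subst Bochner_Integration.integral_add)
      show "integrable ?M (\<lambda>h. real K / real n * indicat_real (?E i) h)"
        by (intro integrable_mult_right integrable_real_indicator) (auto simp: less_top[symmetric])
    qed (auto simp: less_top[symmetric])
    also have "\<dots> \<le> real (t choose j) * (real K / real n) ^ j
        + real K / real n * (real (t choose i) * (real K / real n) ^ i)"
      by (intro add_mono mult_left_mono Suc.IH) auto
    \<comment> \<open>Pascal's rule.\<close>
    also have "\<dots> = real (Suc t choose j) * (real K / real n) ^ j"
      by (simp add: Suc algebra_simps add_divide_distrib)
    finally show ?thesis .
  qed
qed


section \<open>Lower bound\<close>

text \<open>The optimal probability that \<open>Q\<close> holds after \<open>t\<close> further steps from history \<open>h\<close>.\<close>

primrec win_value :: "nat \<Rightarrow> (history \<Rightarrow> bool) \<Rightarrow> nat \<Rightarrow> history \<Rightarrow> real" where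
  "win_value n Q 0 h = of_bool (Q h)"
| "win_value n Q (Suc t) h = (\<Sum>u\<in>{1..n}. MAX v\<in>{1..n}. win_value n Q t ((u, v) # h)) / real n"

lemma Max_win_value_ge:
  "v \<in> {1..n} \<Longrightarrow> win_value n Q t ((u, v) # h) \<le> (MAX v\<in>{1..n}. win_value n Q t ((u, v) # h))"
  by (rule Max_ge) auto

lemma Max_win_value_attained:
  assumes "n > 0"
  obtains v where "v \<in> {1..n}"
    "(MAX v\<in>{1..n}. win_value n Q t ((u, v) # h)) = win_value n Q t ((u, v) # h)"
proof -
  have "(MAX v\<in>{1..n}. win_value n Q t ((u, v) # h)) \<in> (\<lambda>v. win_value n Q t ((u, v) # h)) ` {1..n}"
    using assms by (intro Max_in) auto
  then show ?thesis using that by (elim imageE) auto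
qed

lemma win_value_bounds:
  assumes "n > 0"
  shows "0 \<le> win_value n Q t h \<and> win_value n Q t h \<le> 1"
proof (induction t arbitrary: h)
  case (Suc t)
  let ?m = "\<lambda>u. MAX v\<in>{1..n}. win_value n Q t ((u, v) # h)"
  have m: "0 \<le> ?m u \<and> ?m u \<le> 1" for u
  proof -
    obtain v where "v \<in> {1..n}" "?m u = win_value n Q t ((u, v) # h)"
      using Max_win_value_attained[OF assms, of Q t u h] .
    then show ?thesis using Suc.IH[of "(u, v) # h"] by simp
  qed
  have "0 \<le> (\<Sum>u\<in>{1..n}. ?m u)" by (rule sum_nonneg) (simp only: m)
  moreover have "(\<Sum>u\<in>{1..n}. ?m u) \<le> (\<Sum>u\<in>{1..n}. 1)" by (rule sum_mono) (simp only: m)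
  ultimately show ?case unfolding win_value.simps using assms by (simp only: divide_le_eq) simp
qed simp

lemma win_value_Suc_ge:
  assumes "z \<in> {1..n}"
  shows "(\<Sum>u\<in>{1..n}. win_value n Q t ((u, z) # h)) / real n \<le> win_value n Q (Suc t) h"
  unfolding win_value.simps
  by (intro divide_right_mono sum_mono Max_win_value_ge assms) simp

text \<open>Play optimally for \<open>Q'\<close> during \<open>s\<close> steps and, if it holds
  then, for \<open>Q\<close> during the remaining \<open>t\<close> steps. Later histories contain
  \<open>h\<close>, so edges already present stay available.\<close>

lemma win_value_add_ge:
  assumes n: "n > 0" and b: "0 \<le> b"
    and Q: "\<And>h'. set h \<subseteq> set h' \<Longrightarrow> Q' h' \<Longrightarrow> b \<le> win_value n Q t h'"
  shows "b * win_value n Q' s h \<le> win_value n Q (s + t) h"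
  using Q
proof (induction s arbitrary: h)
  case 0
  then show ?case using win_value_bounds[OF n, of Q t h] by auto
next
  case (Suc s)
  let ?m' = "\<lambda>u. MAX v\<in>{1..n}. win_value n Q' s ((u, v) # h)"
  let ?m = "\<lambda>u. MAX v\<in>{1..n}. win_value n Q (s + t) ((u, v) # h)"
  have "b * ?m' u \<le> ?m u" for u
  proof -
    obtain v where v: "v \<in> {1..n}" "?m' u = win_value n Q' s ((u, v) # h)"
      using Max_win_value_attained[OF n, of Q' s u h] .
    have "b * win_value n Q' s ((u, v) # h) \<le> win_value n Q (s + t) ((u, v) # h)"
      by (rule Suc.IH) (use Suc.prems in auto)
    then show ?thesis using v(2) Max_win_value_ge[OF v(1), of Q "s + t" u h] by simp
  qed
  then have "(\<Sum>u\<in>{1..n}. b * ?m' u) / real n \<le> (\<Sum>u\<in>{1..n}. ?m u) / real n"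
    by (intro divide_right_mono sum_mono) auto
  then show ?case by (simp add: sum_distrib_left)
qed

lemma win_value_mono:
  assumes "n > 0" "\<And>h'. set h \<subseteq> set h' \<Longrightarrow> Q' h' \<Longrightarrow> Q h'"
  shows "win_value n Q' t h \<le> win_value n Q t h"
  using win_value_add_ge[of n 1 h Q' Q 0 t] assms by simp

lemma win_value_eq_1:
  assumes "n > 0" "\<And>h'. set h \<subseteq> set h' \<Longrightarrow> Q h'"
  shows "win_value n Q t h = 1"
proof -
  have "win_value n (\<lambda>_. True) t h = 1" for h
    using assms(1) by (induction t arbitrary: h) auto
  then show ?thesis
    using win_value_mono[OF assms(1), of h "\<lambda>_. True" Q t] assms(2) win_value_bounds[OF assms(1), of Q t h]
    by simp
qed

text \<open>Backward induction: always picking a maximising circle turns the value of the current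
  history into a martingale that ends at the indicator of \<open>Q\<close>.\<close>

lemma win_value_attained:
  assumes n: "n > 0"
  shows "\<exists>S. valid_strategy n S \<and>
    win_value n Q T [] \<le> measure_pmf.prob (semi_random_process n S T) {h. Q h}"
proof -
  let ?w = "win_value n Q"
  \<comment> \<open>The number of remaining steps is read off from the length of the history, so
    this time-dependent choice is a strategy.\<close>
  have "\<forall>h u. \<exists>v. v \<in> {1..n} \<and>
      (MAX v\<in>{1..n}. ?w (T - Suc (length h)) ((u, v) # h)) = ?w (T - Suc (length h)) ((u, v) # h)"
    using Max_win_value_attained[OF n] by metis
  then obtain c where c: "\<And>h u. c h u \<in> {1..n}"
    "\<And>h u. (MAX v\<in>{1..n}. ?w (T - Suc (length h)) ((u, v) # h)) = ?w (T - Suc (length h)) ((u, c h u) # h)"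
    by metis
  define S :: strategy where "S h u = return_pmf (c h u)" for h u
  let ?M = "semi_random_process n S"
  have len: "h \<in> set_pmf (?M s) \<Longrightarrow> length h = s" for h s
    by (induction s arbitrary: h) auto
  have "s \<le> T \<Longrightarrow> (\<integral>\<^sup>+h. ennreal (?w (T - s) h) \<partial>?M s) = ennreal (?w T [])" for s
  proof (induction s)
    case 0
    then show ?case by simp
  next
    case (Suc s)
    have "(\<integral>\<^sup>+h. ennreal (?w (T - Suc s) h) \<partial>?M (Suc s))
        = (\<integral>\<^sup>+h. \<integral>\<^sup>+u. ennreal (?w (T - Suc s) ((u, c h u) # h)) \<partial>pmf_of_set {1..n} \<partial>?M s)"
      by (simp add: S_def)
    also have "\<dots> = (\<integral>\<^sup>+h. ennreal (?w (T - s) h) \<partial>?M s)"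
    proof (rule nn_integral_cong_AE, unfold AE_measure_pmf_iff, rule ballI)
      fix h assume "h \<in> set_pmf (?M s)"
      then have l: "length h = s" by (rule len)
      obtain r where r: "T - s = Suc r" "r = T - Suc s" using Suc.prems by (metis Suc_diff_Suc Suc_le_eq)
      have "(\<integral>\<^sup>+u. ennreal (?w (T - Suc s) ((u, c h u) # h)) \<partial>pmf_of_set {1..n})
          = (\<Sum>u\<in>{1..n}. ennreal (?w r ((u, c h u) # h))) / ennreal (real n)"
        using n r by (subst nn_integral_pmf_of_set) (auto simp: ennreal_of_nat_eq_real_of_nat)
      also have "\<dots> = ennreal ((\<Sum>u\<in>{1..n}. ?w r ((u, c h u) # h)) / real n)"
        using n win_value_bounds[OF n] by (subst sum_ennreal) (auto intro!: divide_ennreal sum_nonneg)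
      also have "(\<Sum>u\<in>{1..n}. ?w r ((u, c h u) # h)) / real n = ?w (T - s) h"
        unfolding r(1) win_value.simps using c(2)[of h] l r(2) by simp
      finally show "(\<integral>\<^sup>+u. ennreal (?w (T - Suc s) ((u, c h u) # h)) \<partial>pmf_of_set {1..n})
          = ennreal (?w (T - s) h)" .
    qed
    also have "\<dots> = ennreal (?w T [])" using Suc by simp
    finally show ?case .
  qed
  from this[of T] have "ennreal (?w T []) = (\<integral>\<^sup>+h. indicator {h. Q h} h \<partial>?M T)"
    by (simp add: indicator_def of_bool_def if_distrib cong: if_cong)
  also have "\<dots> = ennreal (measure_pmf.prob (?M T) {h. Q h})"
    by (simp add: measure_pmf.emeasure_eq_measure)
  finally have "?w T [] \<le> measure_pmf.prob (?M T) {h. Q h}"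
    using win_value_bounds[OF n, of Q T "[]"] by (simp add: ennreal_inj)
  moreover have "valid_strategy n S" using c(1) by (simp add: valid_strategy_def S_def)
  ultimately show ?thesis by blast
qed

section \<open>Hitting many candidates with a repeated circle\<close>

definition hits :: "nat set \<Rightarrow> nat \<Rightarrow> history \<Rightarrow> nat set" where
  "hits A z h = {u \<in> A. (u, z) \<in> set h}"

lemma card_hits_Cons:
  assumes "finite A"
  shows "card (hits A z ((u, z) # h)) = card (hits A z h) + of_bool (u \<in> A - hits A z h)"
proof -
  have "hits A z ((u, z) # h) = (if u \<in> A then insert u (hits A z h) else hits A z h)"
    by (auto simp: hits_def)
  moreover have "finite (hits A z h)" using assms by (simp add: hits_def)
  ultimately show ?thesis by (auto simp: card_insert_if)
qed

text \<open>Gives \<open>1 - exp (- 1) \<ge> 3 / 5\<close>, the constant in the potential argument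
  below.\<close>

lemma exp_minus_one_le: "exp (- 1 :: real) \<le> 2 / 5"
proof -
  have "5 / 2 \<le> exp (1 :: real)"
    using exp_lower_Taylor_quadratic[of 1] by simp
  then have "inverse (exp 1) \<le> inverse (5 / 2 :: real)" by (rule le_imp_inverse_le) simp
  then show ?thesis by (simp add: exp_minus)
qed

text \<open>The player always picks \<open>z\<close>. While fewer than \<open>m\<close> points of \<open>A\<close> are hit, every step hits a new
  one with probability at least \<open>p\<close>, which multiplies the exponential potential by at most
  \<open>1 - p (1 - 1/e)\<close> in expectation.\<close>

lemma win_value_hits_exp:
  assumes n: "n > 0" and z: "z \<in> {1..n}" and A: "A \<subseteq> {1..n}"
    and m: "0 \<le> m" and p: "0 \<le> p" "p * real n \<le> real (card A) - m"
  shows "1 - win_value n (\<lambda>h. m \<le> real (card (hits A z h))) s h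
    \<le> exp (m - real (card (hits A z h))) * (1 - 3 / 5 * p) ^ s"
proof -
  have finA: "finite A" using A finite_subset by blast
  let ?Q = "\<lambda>h. m \<le> real (card (hits A z h))"
  have "p * real n \<le> 1 * real n" using p(2) m card_mono[OF _ A] by simp
  then have p1: "p \<le> 1" using n by (simp only: mult_le_cancel_right)
  \<comment> \<open>Once reached, the target persists, so the failure probability is 0;
    \<open>p1\<close> keeps the right-hand side nonnegative.\<close>
  have hit: "1 - win_value n ?Q s h \<le> exp (m - real (card (hits A z h))) * (1 - 3 / 5 * p) ^ s"
    if "?Q h" for s h
  proof -
    have "?Q h'" if "set h \<subseteq> set h'" for h'
    proof -
      have "card (hits A z h) \<le> card (hits A z h')"
        using that finA by (intro card_mono) (auto simp: hits_def)
      then show ?thesis using \<open>?Q h\<close> by linarith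
    qed
    then have "win_value n ?Q s h = 1" by (rule win_value_eq_1[OF n])
    then show ?thesis using p1 by simp
  qed
  show ?thesis
  proof (induction s arbitrary: h)
    case 0
    show ?case using hit[of h 0] by (cases "?Q h") auto
  next
    case (Suc s)
    show ?case
    proof (cases "?Q h")
      case True
      then show ?thesis by (rule hit)
    next
      case False
      let ?N = "A - hits A z h" and ?r = "1 - 3 / 5 * p" and ?e = "exp (m - real (card (hits A z h)))"
      let ?w = "\<lambda>u. win_value n ?Q s ((u, z) # h)"
      have "real (card ?N) = real (card A) - real (card (hits A z h))"
        using finA by (subst card_Diff_subset) (auto simp: hits_def card_mono of_nat_diff)
      then have N: "p * real n \<le> real (card ?N)" using False p(2) by linarith
      have w: "1 - ?w u \<le> ?e * ?r ^ s * (1 - 3 / 5 * indicator ?N u)" if "u \<in> {1..n}" for u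
      proof -
        have "1 - ?w u \<le> exp (m - real (card (hits A z ((u, z) # h)))) * ?r ^ s" by (rule Suc.IH)
        \<comment> \<open>The exponent drops by 1 exactly when \<open>u\<close> is a new point of
          \<open>A\<close>; \<open>exp_minus_one_le\<close> then makes the factor linear in the
          indicator.\<close>
        also have "m - real (card (hits A z ((u, z) # h))) = (m - real (card (hits A z h))) + - indicator ?N u"
          using card_hits_Cons[OF finA, of z u h] by (auto simp: indicator_def)
        also have "exp \<dots> = ?e * exp (- indicator ?N u)" by (rule exp_add)
        also have "?e * exp (- indicator ?N u) * ?r ^ s \<le> ?e * (1 - 3 / 5 * indicator ?N u) * ?r ^ s"
          using p1 exp_minus_one_le by (intro mult_right_mono mult_left_mono) (auto simp: indicator_def)
        finally show ?thesis by (simp add: algebra_simps)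
      qed
      have "1 - win_value n ?Q (Suc s) h \<le> 1 - (\<Sum>u\<in>{1..n}. ?w u) / real n"
        using win_value_Suc_ge[OF z, of ?Q s h] by simp
      also have "\<dots> = (\<Sum>u\<in>{1..n}. 1 - ?w u) / real n"
        using n by (simp add: sum_subtractf diff_divide_distrib)
      also have "\<dots> \<le> (\<Sum>u\<in>{1..n}. ?e * ?r ^ s * (1 - 3 / 5 * indicator ?N u)) / real n"
        by (intro divide_right_mono sum_mono w) auto
      also have "\<dots> = ?e * ?r ^ s * ((\<Sum>u\<in>{1..n}. 1 - 3 / 5 * indicator ?N u) / real n)"
        by (simp add: sum_distrib_left)
      also have "(\<Sum>u\<in>{1..n}. 1 - 3 / 5 * indicator ?N u) = real n - 3 / 5 * real (card ?N)"
      proof -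
        have "(\<Sum>u\<in>{1..n}. indicat_real ?N u) = real (card ({1..n} \<inter> ?N))"
          by (simp add: indicator_def set_diff_eq)
        moreover have "{1..n} \<inter> ?N = ?N" using A by blast
        ultimately have "(\<Sum>u\<in>{1..n}. indicat_real ?N u) = real (card ?N)" by simp
        then show ?thesis by (simp only: sum_subtractf sum_distrib_left[symmetric]) simp
      qed
      also have "?e * ?r ^ s * ((real n - 3 / 5 * real (card ?N)) / real n) \<le> ?e * ?r ^ s * ?r"
      proof (rule mult_left_mono)
        have "real n - 3 / 5 * real (card ?N) \<le> ?r * real n" using N by (simp add: algebra_simps)
        then show "(real n - 3 / 5 * real (card ?N)) / real n \<le> ?r" using n by (simp add: pos_divide_le_eq)
      qed (use p1 in simp)
      finally show ?thesis by (simp add: algebra_simps)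
    qed
  qed
qed

text \<open>As \<open>s \<le> 2 * n\<close>, the target is at most half of \<open>card A\<close>, so
  the rate \<open>p = card A / (2 * n)\<close> is admissible. Since \<open>p * s = 2 * m\<close>,
  the exponent becomes \<open>m - 3 / 5 * (2 * m) = - m / 5\<close>.\<close>

lemma win_value_hits:
  fixes n s :: nat and A :: "nat set"
  defines "m \<equiv> real (card A) * (real s / (4 * real n))"
  assumes n: "n > 0" and z: "z \<in> {1..n}" and A: "A \<subseteq> {1..n}" and s: "s \<le> 2 * n"
  shows "1 - exp (- m / 5) \<le> win_value n (\<lambda>h. m \<le> real (card (hits A z h))) s h"
proof -
  define p where "p = real (card A) / (2 * real n)"
  have m0: "0 \<le> m" by (simp add: m_def)
  have "real s / (4 * real n) \<le> 1 / 2" using s n by (simp add: divide_le_eq)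
  then have "m \<le> real (card A) * (1 / 2)" unfolding m_def by (rule mult_left_mono) simp
  then have pn: "p * real n \<le> real (card A) - m" using n by (simp add: p_def)
  have ps: "p * real s = 2 * m" using n by (simp add: p_def m_def)
  have "p \<le> 1" using card_mono[OF _ A] n by (simp add: p_def divide_le_eq)
  have "1 - win_value n (\<lambda>h. m \<le> real (card (hits A z h))) s h
      \<le> exp (m - real (card (hits A z h))) * (1 - 3 / 5 * p) ^ s"
    by (rule win_value_hits_exp[OF n z A m0 _ pn]) (simp add: p_def)
  also have "\<dots> \<le> exp m * exp (- (3 / 5 * p)) ^ s"
    using \<open>p \<le> 1\<close> exp_ge_add_one_self[of "- (3 / 5 * p)"] by (intro mult_mono power_mono) auto
  also have "\<dots> = exp (m + real s * (- (3 / 5 * p)))"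
    by (simp only: exp_add exp_of_nat_mult)
  also have "m + real s * (- (3 / 5 * p)) = - m / 5" using ps by (simp add: algebra_simps)
  finally show ?thesis by linarith
qed

text \<open>In the phase of \<open>z\<close> the set of candidates shrinks by a factor of about \<open>s / n\<close>; the factor
  \<open>s / (4 n)\<close> leaves room for the deviation.\<close>

lemma win_value_common_hit:
  fixes n s :: nat and c :: real
  assumes n: "n > 0" and s: "s \<le> 2 * n" and c: "0 < c"
    and "set zs \<subseteq> {1..n}" "A \<subseteq> {1..n}" "c \<le> real (card A) * (real s / (4 * real n)) ^ length zs"
  shows "(1 - exp (- c / 5)) ^ length zs
    \<le> win_value n (\<lambda>h. \<exists>u\<in>A. \<forall>z\<in>set zs. (u, z) \<in> set h) (length zs * s) h"
  using assms(4-6)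
proof (induction zs arbitrary: A h)
  case Nil
  then have "A \<noteq> {}" using c by auto
  then show ?case by auto
next
  case (Cons z zs)
  let ?r = "real s / (4 * real n)" and ?b = "(1 - exp (- c / 5)) ^ length zs"
  let ?m = "real (card A) * ?r"
  let ?Q = "\<lambda>h. \<exists>u\<in>A. \<forall>z\<in>set (z # zs). (u, z) \<in> set h"
  let ?Q' = "\<lambda>h. ?m \<le> real (card (hits A z h))"
  have r: "0 \<le> ?r" "?r \<le> 1" using s n by (auto simp: divide_le_eq)
  have "c \<le> ?m * ?r ^ length zs" using Cons.prems(3) by (simp add: mult.assoc)
  moreover have "?m * ?r ^ length zs \<le> ?m * 1"
    using r by (intro mult_left_mono power_le_one) auto
  \<comment> \<open>As \<open>?r \<le> 1\<close>, the final count \<open>c\<close> also bounds the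
    target of the present phase, so one failure bound \<open>exp (- c / 5)\<close> serves all
    phases.\<close>
  ultimately have cm: "c \<le> ?m * ?r ^ length zs" "c \<le> ?m" by auto
  have b: "0 \<le> ?b" using c by simp
  have "1 - exp (- c / 5) \<le> 1 - exp (- ?m / 5)"
    using cm(2) by (intro diff_left_mono exp_le_cancel_iff[THEN iffD2] divide_right_mono) auto
  also have "\<dots> \<le> win_value n ?Q' s h"
    using Cons.prems by (intro win_value_hits[OF n _ _ s]) auto
  finally have "(1 - exp (- c / 5)) * ?b \<le> win_value n ?Q' s h * ?b"
    using b by (rule mult_right_mono)
  then have "(1 - exp (- c / 5)) ^ length (z # zs) \<le> ?b * win_value n ?Q' s h"
    by (simp only: list.size power_add power_one_right mult.commute add_Suc_right add_0_right power_Suc)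
  also have "\<dots> \<le> win_value n ?Q (s + length zs * s) h"
  proof (rule win_value_add_ge[OF n b])
    \<comment> \<open>The points hit become the candidates for the remaining circles; their edges to
      \<open>z\<close> persist.\<close>
    fix h' assume "?Q' h'"
    then have "?m * ?r ^ length zs \<le> real (card (hits A z h')) * ?r ^ length zs"
      using r by (intro mult_right_mono) auto
    then have "c \<le> real (card (hits A z h')) * ?r ^ length zs" using cm(1) by (rule order.trans[rotated])
    then have "?b \<le> win_value n (\<lambda>h. \<exists>u\<in>hits A z h'. \<forall>z\<in>set zs. (u, z) \<in> set h) (length zs * s) h'"
      using Cons.prems(1,2) by (intro Cons.IH) (auto simp: hits_def)
    also have "\<dots> \<le> win_value n ?Q (length zs * s) h'"
      by (rule win_value_mono[OF n]) (auto simp: hits_def)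
    finally show "?b \<le> win_value n ?Q (length zs * s) h'" .
  qed
  finally show ?case by simp
qed

section \<open>Embedding one vertex at a time\<close>

text \<open>Only edges inside \<open>U\<close> are required and \<open>f\<close> is arbitrary
  outside \<open>U\<close>, so a partial embedding extends by changing one value.\<close>

definition embeds :: "nat \<Rightarrow> history \<Rightarrow> 'a ugraph \<Rightarrow> 'a set \<Rightarrow> ('a \<Rightarrow> nat) \<Rightarrow> bool" where
  "embeds n h H U f \<longleftrightarrow> inj_on f U \<and> f ` U \<subseteq> {1..n} \<and>
     (\<forall>e\<in>edges H. e \<subseteq> U \<longrightarrow> f ` e \<in> edges (history_graph n h))"

lemma embeds_extend:
  assumes H: "simple_graph H" and v: "v \<in> U" and f: "embeds n h H (U - {v}) f"
    and u: "u \<in> {1..n} - f ` (U - {v})" and sub: "set h \<subseteq> set h'"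
    and uh: "\<And>w. w \<in> U \<Longrightarrow> {v, w} \<in> edges H \<Longrightarrow> (u, f w) \<in> set h'"
  shows "embeds n h' H U (f(v := u))"
proof -
  let ?f = "f(v := u)"
  have U: "U = insert v (U - {v})" using v by blast
  have img: "?f ` B = f ` B" if "v \<notin> B" for B using that by (intro image_cong) auto
  have "inj_on ?f (insert v (U - {v}))"
    unfolding inj_on_insert using f u img[of "U - {v}"]
    by (simp add: embeds_def inj_on_fun_updI)
  moreover have "?f ` insert v (U - {v}) \<subseteq> {1..n}"
    using f u img[of "U - {v}"] unfolding embeds_def by auto
  moreover have "?f ` e \<in> edges (history_graph n h')" if e: "e \<in> edges H" "e \<subseteq> U" for e
  proof (cases "v \<in> e")
    case False
    then have "f ` e \<in> edges (history_graph n h)" using f e unfolding embeds_def by blast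
    then show ?thesis using sub img[OF False] by (auto simp: history_graph_def)
  next
    case True
    have "card e = 2" using H e(1) by (auto simp: simple_graph_def)
    then obtain w where w: "e = {v, w}" "w \<noteq> v"
      using True by (auto simp: card_2_iff)
    have "w \<in> U" "(u, f w) \<in> set h'" using uh[of w] e w by auto
    \<comment> \<open>Freshness of \<open>u\<close> rules out a loop, which
      \<open>history_graph\<close> would drop.\<close>
    moreover have "u \<noteq> f w" using u w \<open>w \<in> U\<close> by auto
    ultimately show ?thesis using w by (auto simp: history_graph_def)
  qed
  ultimately show ?thesis unfolding embeds_def U[symmetric] by blast
qed

lemma win_value_embeds_extend:
  fixes c :: real
  assumes H: "simple_graph H" and U: "finite U" "v \<in> U"
    and W: "card {w \<in> U. {v, w} \<in> edges H} \<le> d"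
    and n: "n > 0" and s: "s \<le> 2 * n" and c: "0 < c"
    and cn: "c \<le> (real n - real (card U)) * (real s / (4 * real n)) ^ d"
    and f: "embeds n h H (U - {v}) f"
  shows "(1 - exp (- c / 5)) ^ d \<le> win_value n (\<lambda>h. \<exists>f. embeds n h H U f) (d * s) h"
proof -
  let ?W = "{w \<in> U. {v, w} \<in> edges H}"
  \<comment> \<open>Padding with vertex 1 gives exactly \<open>d\<close> phases, so every vertex of
    \<open>H\<close> costs the same time and has the same success bound.\<close>
  let ?zs = "sorted_list_of_set (f ` ?W) @ replicate (d - card (f ` ?W)) 1"
  let ?A = "{1..n} - f ` (U - {v})"
  have finW: "finite ?W" using U(1) by simp
  have "card (f ` ?W) \<le> d" using card_image_le[OF finW, of f] W by simp
  then have len: "length ?zs = d" by simp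
  have "v \<notin> ?W" using H by (auto simp: simple_graph_def)
  then have "f ` ?W \<subseteq> f ` (U - {v})" by auto
  moreover have fU: "f ` (U - {v}) \<subseteq> {1..n}" using f by (auto simp: embeds_def)
  ultimately have zs: "f ` ?W \<subseteq> set ?zs" "set ?zs \<subseteq> {1..n}" using finW n by auto
  have "card (f ` (U - {v})) \<le> card U"
    using card_image_le[of "U - {v}" f] card_Diff1_le[of U v] U(1) by (meson finite_Diff le_trans)
  moreover have "card ?A = n - card (f ` (U - {v}))"
    using fU U(1) by (subst card_Diff_subset) auto
  ultimately have "real n - real (card U) \<le> real (card ?A)" by linarith
  then have "c \<le> real (card ?A) * (real s / (4 * real n)) ^ length ?zs"
    unfolding len using cn by (elim order.trans) (intro mult_right_mono, auto)
  from win_value_common_hit[OF n s c zs(2) Diff_subset this, of h]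
  have "(1 - exp (- c / 5)) ^ d
      \<le> win_value n (\<lambda>h. \<exists>u\<in>?A. \<forall>z\<in>set ?zs. (u, z) \<in> set h) (d * s) h"
    by (simp only: len)
  also have "\<dots> \<le> win_value n (\<lambda>h. \<exists>f. embeds n h H U f) (d * s) h"
  proof (rule win_value_mono[OF n])
    fix h' assume sub: "set h \<subseteq> set h'" and "\<exists>u\<in>?A. \<forall>z\<in>set ?zs. (u, z) \<in> set h'"
    then obtain u where u: "u \<in> ?A" "\<forall>z\<in>set ?zs. (u, z) \<in> set h'" by (elim bexE)
    have "embeds n h' H U (f(v := u))"
    proof (rule embeds_extend[OF H U(2) f u(1) sub])
      fix w assume "w \<in> U" "{v, w} \<in> edges H"
      then have "f w \<in> f ` ?W" by (intro imageI CollectI conjI)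
      then show "(u, f w) \<in> set h'" by (rule bspec[OF u(2) subsetD[OF zs(1)]])
    qed
    then show "\<exists>f. embeds n h' H U f" by blast
  qed
  finally show ?thesis .
qed

text \<open>Degeneracy is applied to the subgraph induced on \<open>U\<close>; distinct neighbours
  of \<open>v\<close> give distinct edges there.\<close>

lemma degenerate_obtain_vertex:
  assumes H: "simple_graph H" "degenerate d H" and U: "U \<subseteq> verts H" "U \<noteq> {}"
  obtains v where "v \<in> U" "card {w \<in> U. {v, w} \<in> edges H} \<le> d"
proof -
  let ?G = "Graph U {e \<in> edges H. e \<subseteq> U}"
  have finU: "finite U" using H(1) U(1) finite_subset by (auto simp: simple_graph_def)
  then have "subgraph ?G H" using H(1) U by (auto simp: subgraph_def simple_graph_def)
  then obtain v where v: "v \<in> U" "Defs.degree ?G v \<le> d"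
    using H(2) U(2) unfolding degenerate_def by fastforce
  have "inj_on (\<lambda>w. {v, w}) {w \<in> U. {v, w} \<in> edges H}"
    by (auto simp: inj_on_def doubleton_eq_iff)
  then have "card {w \<in> U. {v, w} \<in> edges H} \<le> card {e \<in> edges ?G. v \<in> e}"
  proof (rule card_inj_on_le)
    show "finite {e \<in> edges ?G. v \<in> e}"
      by (rule finite_subset[of _ "Pow U"]) (use finU in auto)
  qed (use v in auto)
  then show ?thesis using that[of v] v by (simp add: Defs.degree_def)
qed

text \<open>The low-degree vertex of \<open>U\<close> is embedded last, after the rest of
  \<open>U\<close>, at the price of \<open>d\<close> phases of length \<open>s\<close> and a factor
  \<open>(1 - exp (- c / 5)) ^ d\<close>.\<close>

lemma win_value_embeds:
  fixes c :: real
  assumes H: "simple_graph H" "degenerate d H"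
    and n: "n > 0" and s: "s \<le> 2 * n" and c: "0 < c"
    and cn: "c \<le> (real n - real (card (verts H))) * (real s / (4 * real n)) ^ d"
    and U: "U \<subseteq> verts H"
  shows "((1 - exp (- c / 5)) ^ d) ^ card U
    \<le> win_value n (\<lambda>h. \<exists>f. embeds n h H U f) (card U * (d * s)) []"
  using U
proof (induction "card U" arbitrary: U)
  case 0
  then have "U = {}" using H(1) finite_subset[of U "verts H"] by (simp add: simple_graph_def)
  moreover have "{} \<notin> edges H" using H(1) by (auto simp: simple_graph_def)
  ultimately show ?case by (auto simp: embeds_def)
next
  case (Suc k)
  have finU: "finite U" using H(1) Suc.prems finite_subset by (auto simp: simple_graph_def)
  have "U \<noteq> {}" using Suc.hyps(2) by auto
  then obtain v where v: "v \<in> U" "card {w \<in> U. {v, w} \<in> edges H} \<le> d"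
    by (rule degenerate_obtain_vertex[OF H Suc.prems])
  let ?b = "(1 - exp (- c / 5)) ^ d" and ?Q = "\<lambda>U h. \<exists>f. embeds n h H U f"
  have k: "card (U - {v}) = k" using Suc.hyps(2) v(1) finU by simp
  have b: "0 \<le> ?b" using c by simp
  have "card U \<le> card (verts H)"
    using H(1) Suc.prems by (intro card_mono) (auto simp: simple_graph_def)
  then have "(real n - real (card (verts H))) * (real s / (4 * real n)) ^ d
      \<le> (real n - real (card U)) * (real s / (4 * real n)) ^ d"
    by (intro mult_right_mono) auto
  then have cU: "c \<le> (real n - real (card U)) * (real s / (4 * real n)) ^ d" using cn by linarith
  have "?b ^ k \<le> win_value n (?Q (U - {v})) (k * (d * s)) []"
    using Suc.hyps(1)[of "U - {v}"] k Suc.prems by auto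
  then have "?b ^ card U \<le> ?b * win_value n (?Q (U - {v})) (k * (d * s)) []"
    using b Suc.hyps(2)[symmetric] by (simp add: mult_left_mono)
  also have "\<dots> \<le> win_value n (?Q U) (k * (d * s) + d * s) []"
  proof (rule win_value_add_ge[OF n b])
    fix h assume "?Q (U - {v}) h"
    then show "?b \<le> win_value n (?Q U) (d * s) h"
      by (elim exE) (rule win_value_embeds_extend[OF H(1) finU v n s c cU])
  qed
  also have "k * (d * s) + d * s = card U * (d * s)" using Suc.hyps(2)[symmetric] by simp
  finally show ?case .
qed

text \<open>Steps after the embedding only add edges, so the copy persists until time
  \<open>t\<close>.\<close>

lemma strategy_contains_copy:
  fixes c :: real
  assumes H: "simple_graph H" "degenerate d H"
    and n: "n > 0" and s: "s \<le> 2 * n" and c: "0 < c"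
    and cn: "c \<le> (real n - real (card (verts H))) * (real s / (4 * real n)) ^ d"
    and t: "card (verts H) * (d * s) \<le> t"
  shows "\<exists>S. valid_strategy n S \<and> ((1 - exp (- c / 5)) ^ d) ^ card (verts H)
    \<le> measure_pmf.prob (semi_random_graph n S t) {G. contains_copy G H}"
proof -
  let ?Q = "\<lambda>h. \<exists>f. embeds n h H (verts H) f" and ?t = "card (verts H) * (d * s)"
  let ?R = "\<lambda>h. contains_copy (history_graph n h) H"
  have QR: "?R h'" if "?Q h" "set h \<subseteq> set h'" for h h'
  proof -
    have "e \<subseteq> verts H" if "e \<in> edges H" for e using H(1) that by (auto simp: simple_graph_def)
    moreover have "edges (history_graph n h) \<subseteq> edges (history_graph n h')"
      using that(2) by (auto simp: history_graph_def)
    moreover have "verts (history_graph n h') = {1..n}" by (simp add: history_graph_def)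
    ultimately show ?thesis using that(1) unfolding contains_copy_def embeds_def by (metis subsetD)
  qed
  have "((1 - exp (- c / 5)) ^ d) ^ card (verts H) \<le> 1 * win_value n ?Q ?t []"
    using win_value_embeds[OF H n s c cn order.refl] by simp
  also have "\<dots> \<le> win_value n ?R (?t + (t - ?t)) []"
  proof (rule win_value_add_ge[OF n])
    fix h' assume "?Q h'"
    then show "1 \<le> win_value n ?R (t - ?t) h'"
      using QR win_value_eq_1[OF n, of h' ?R] by auto
  qed simp
  also have "?t + (t - ?t) = t" using t by simp
  finally show ?thesis
    using win_value_attained[OF n, of ?R t]
    by (auto simp: semi_random_graph_def vimage_def intro: order.trans)
qed


section \<open>The threshold\<close>

lemma degenerate_mono: "degenerate d G \<Longrightarrow> d \<le> d' \<Longrightarrow> degenerate d' G"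
  unfolding degenerate_def by (meson le_trans)

text \<open>A crude bound that makes the \<open>LEAST\<close> in \<open>degeneracy\<close> range
  over a nonempty set.\<close>

lemma degenerate_card_edges:
  assumes "simple_graph G"
  shows "degenerate (card (edges G)) G"
  unfolding degenerate_def
proof (intro allI impI, elim conjE)
  fix H assume H: "subgraph H G" "verts H \<noteq> {}"
  have "finite (edges G)"
    by (rule finite_subset[of _ "Pow (verts G)"]) (use assms in \<open>auto simp: simple_graph_def\<close>)
  moreover have "{e \<in> edges H. v \<in> e} \<subseteq> edges G" for v
    using H(1) by (auto simp: subgraph_def)
  ultimately have "Defs.degree H v \<le> card (edges G)" for v
    unfolding Defs.degree_def by (rule card_mono)
  then show "\<exists>v\<in>verts H. Defs.degree H v \<le> card (edges G)" using H(2) by auto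
qed

lemma degenerate_degeneracy:
  assumes "simple_graph G"
  shows "degenerate (degeneracy G) G"
  unfolding degeneracy_def using degenerate_card_edges[OF assms] by (rule LeastI)

text \<open>In the subgraph induced on a cycle every vertex lies on two cycle edges; chords only add
  to its degree.\<close>

lemma not_degenerate_1_if_cycle:
  assumes G: "simple_graph G" and cyc: "is_cycle G vs"
  shows "\<not> degenerate 1 G"
proof
  assume "degenerate 1 G"
  let ?l = "length vs" and ?C = "Graph (set vs) {e \<in> edges G. e \<subseteq> set vs}"
  have l: "3 \<le> ?l" and dist: "distinct vs"
    and e: "\<And>i. i < ?l \<Longrightarrow> {vs ! i, vs ! (Suc i mod ?l)} \<in> edges G"
    using cyc by (auto simp: is_cycle_def)
  have edge: "{vs ! i, vs ! (Suc i mod ?l)} \<in> edges ?C" if "i < ?l" for i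
  proof -
    have "vs ! (Suc i mod ?l) \<in> set vs" using l by (intro nth_mem mod_less_divisor) linarith
    then show ?thesis using e[OF that] that by simp
  qed
  have "set vs \<subseteq> verts G"
  proof
    fix x assume "x \<in> set vs"
    then obtain i where "i < ?l" "x = vs ! i" by (auto simp: in_set_conv_nth)
    then show "x \<in> verts G" using e[of i] G by (auto simp: simple_graph_def)
  qed
  then have "subgraph ?C G" using G by (auto simp: subgraph_def simple_graph_def)
  moreover have "set vs \<noteq> {}" using l by auto
  ultimately obtain x where x: "x \<in> set vs" "Defs.degree ?C x \<le> 1"
    using \<open>degenerate 1 G\<close> unfolding degenerate_def by fastforce
  obtain i where i: "i < ?l" "x = vs ! i" using x(1) by (auto simp: in_set_conv_nth)
  \<comment> \<open>Positions of the predecessor and the successor, with wrap-around; they differ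
    because the length is at least 3.\<close>
  define j where "j = (if i = 0 then ?l - 1 else i - 1)"
  define k where "k = Suc i mod ?l"
  have j: "j < ?l" "Suc j mod ?l = i" using i l by (auto simp: j_def)
  have k: "k = (if Suc i = ?l then 0 else Suc i)" using i(1) by (auto simp: k_def)
  then have "k < ?l" using i(1) by auto
  have "j \<noteq> k" using k i(1) l by (auto simp: j_def split: if_splits)
  then have "vs ! j \<noteq> vs ! k" using dist j(1) \<open>k < ?l\<close> by (simp add: nth_eq_iff_index_eq)
  then have ne: "{x, vs ! k} \<noteq> {x, vs ! j}" by (auto simp: doubleton_eq_iff)
  have "{{x, vs ! k}, {x, vs ! j}} \<subseteq> {e \<in> edges ?C. x \<in> e}"
    using edge[OF i(1)] edge[OF j(1)] i(2) j(2) by (simp add: k_def insert_commute)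
  moreover have "finite {e \<in> edges ?C. x \<in> e}"
    by (rule finite_subset[of _ "Pow (set vs)"]) auto
  ultimately have "card {{x, vs ! k}, {x, vs ! j}} \<le> Defs.degree ?C x"
    unfolding Defs.degree_def by (intro card_mono)
  then show False using ne x(2) by simp
qed

text \<open>The exclusion of forests enters here; it makes the exponent \<open>(d - 1) / d\<close>
  positive.\<close>

lemma degeneracy_ge_2:
  assumes "simple_graph G" "\<not> forest G"
  shows "2 \<le> degeneracy G"
proof (rule ccontr)
  assume "\<not> 2 \<le> degeneracy G"
  then have "degenerate 1 G" using degenerate_mono[OF degenerate_degeneracy[OF assms(1)], of 1] by simp
  then show False using not_degenerate_1_if_cycle[OF assms(1)] assms by (auto simp: forest_def)
qed

section \<open>Upper bound at the threshold scale\<close>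

text \<open>Failure of \<open>(d - 1)\<close>-degeneracy yields a nonempty subgraph of minimum
  degree at least \<open>d\<close>, so every copy exposes some vertex \<open>d\<close> times. The
  common size bound \<open>k\<close> lets one radius serve all of \<open>L\<close>.\<close>

lemma prob_contains_copy_le:
  assumes S: "valid_strategy n S" and n: "n > 0" and d: "d > 0"
    and L: "\<And>H. H \<in> L \<Longrightarrow> simple_graph H \<and> \<not> degenerate (d - 1) H \<and> card (verts H) \<le> k"
  shows "measure_pmf.prob (semi_random_graph n S t) {G. \<exists>H\<in>L. contains_copy G H}
    \<le> real n * (real t * (real (d ^ k\<^sup>2) / real n)) ^ d"
proof -
  let ?M = "semi_random_process n S t" and ?N = "k\<^sup>2" and ?q = "real (d ^ k\<^sup>2) / real n"
  let ?E = "\<lambda>p. {h. d \<le> exposure ?N (d ^ ?N) h p}"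
  have exposed: "\<exists>p\<in>{1..n}. h \<in> ?E p"
    if h: "h \<in> set_pmf ?M" and H: "H \<in> L" "contains_copy (history_graph n h) H" for h H
  proof -
    obtain H' where H': "subgraph H' H" "verts H' \<noteq> {}" "\<forall>v\<in>verts H'. \<not> Defs.degree H' v \<le> d - 1"
      using L[OF H(1)] unfolding degenerate_def by blast
    have "card (verts H) ^ 2 \<le> ?N" using L[OF H(1)] by (intro power_mono) auto
    moreover have "\<And>v. v \<in> verts H' \<Longrightarrow> d \<le> Defs.degree H' v" using H'(3) by fastforce
    moreover have "finite (verts H)" using L[OF H(1)] by (simp add: simple_graph_def)
    ultimately have "\<exists>p\<in>{1..n}. d \<le> exposure ?N (d ^ ?N) h p"
      using exposed_of_copy[OF H'(1,2) _ d _ _ set_semi_random_process[OF S n h] H(2)] by blast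
    then show ?thesis by simp
  qed
  have "measure_pmf.prob (semi_random_graph n S t) {G. \<exists>H\<in>L. contains_copy G H}
      = measure_pmf.prob ?M {h. \<exists>H\<in>L. contains_copy (history_graph n h) H}"
    by (simp add: semi_random_graph_def vimage_def)
  also have "\<dots> \<le> measure_pmf.prob ?M (\<Union>p\<in>{1..n}. ?E p)"
  proof (rule measure_pmf.finite_measure_mono_AE)
    show "AE h in ?M. h \<in> {h. \<exists>H\<in>L. contains_copy (history_graph n h) H} \<longrightarrow> h \<in> (\<Union>p\<in>{1..n}. ?E p)"
      unfolding AE_measure_pmf_iff using exposed by blast
  qed simp
  also have "\<dots> \<le> (\<Sum>p\<in>{1..n}. measure_pmf.prob ?M (?E p))"
    by (rule measure_pmf.finite_measure_subadditive_finite) auto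
  also have "\<dots> \<le> (\<Sum>p\<in>{1..n}. (real t * ?q) ^ d)"
  proof (rule sum_mono)
    fix p
    have "measure_pmf.prob ?M (?E p) \<le> real (t choose d) * ?q ^ d" by (rule prob_exposure_ge[OF n])
    also have "t choose d \<le> t ^ d" by (cases "d \<le> t") (auto simp: binomial_le_pow binomial_eq_0)
    then have "real (t choose d) * ?q ^ d \<le> real (t ^ d) * ?q ^ d"
      by (intro mult_right_mono) (auto simp del: of_nat_power)
    finally show "measure_pmf.prob ?M (?E p) \<le> (real t * ?q) ^ d"
      by (simp only: power_mult_distrib of_nat_power)
  qed
  finally show ?thesis by simp
qed

text \<open>With \<open>x = n powr ((d - 1) / d)\<close> this says
  \<open>n * (x / n) ^ d = 1\<close>: at this scale both bounds are of constant order.\<close>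

lemma powr_frac_power:
  assumes "d > 0" "n > 0"
  shows "real n * (real n powr ((real d - 1) / real d)) ^ d = real n ^ d"
proof -
  have "(real n powr ((real d - 1) / real d)) ^ d = real n powr (real d * ((real d - 1) / real d))"
    using assms by (subst powr_power) (simp_all add: mult.commute)
  also have "real d * ((real d - 1) / real d) = real (d - 1)" using assms by (simp add: of_nat_diff)
  also have "real n powr real (d - 1) = real n ^ (d - 1)" using assms(2) by (intro powr_realpow) simp
  finally show ?thesis using assms(1) by (simp add: power_eq_if)
qed

text \<open>\<open>\<alpha>\<close> is chosen so that
  \<open>\<alpha> * d ^ k\<^sup>2 = 1 / 2\<close>; the union bound becomes
  \<open>(1 / 2) ^ d\<close>. Rounding the time down only helps.\<close>

lemma prob_contains_copy_le_half:
  fixes d k :: nat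
  defines "\<alpha> \<equiv> 1 / (2 * real (d ^ k\<^sup>2))"
  assumes S: "valid_strategy n S" and n: "n > 0" and d: "d > 0"
    and L: "\<And>H. H \<in> L \<Longrightarrow> simple_graph H \<and> \<not> degenerate (d - 1) H \<and> card (verts H) \<le> k"
  shows "measure_pmf.prob
      (semi_random_graph n S (nat \<lfloor>\<alpha> * real n powr ((real d - 1) / real d)\<rfloor>))
      {G. \<exists>H\<in>L. contains_copy G H} \<le> 1 / 2"
proof -
  define x where "x = real n powr ((real d - 1) / real d)"
  define t where "t = nat \<lfloor>\<alpha> * x\<rfloor>"
  let ?K = "real (d ^ k\<^sup>2)"
  have K: "?K > 0" using d by simp
  have "0 \<le> \<alpha> * x" by (simp add: \<alpha>_def x_def)
  then have t: "real t \<le> \<alpha> * x" by (simp add: t_def)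
  have "measure_pmf.prob (semi_random_graph n S t) {G. \<exists>H\<in>L. contains_copy G H}
      \<le> real n * (real t * (?K / real n)) ^ d"
    by (rule prob_contains_copy_le[OF S n d L])
  also have "\<dots> \<le> real n * (\<alpha> * x * (?K / real n)) ^ d"
    using t by (intro mult_left_mono power_mono mult_right_mono) auto
  also have "\<alpha> * x * (?K / real n) = x / (2 * real n)"
    using K unfolding \<alpha>_def by (simp only: divide_simps) simp
  also have "real n * (x / (2 * real n)) ^ d = (real n * x ^ d) / (2 * real n) ^ d"
    by (simp add: power_divide)
  also have "\<dots> = (1 / 2) ^ d"
    using powr_frac_power[OF d n] n by (simp add: x_def power_mult_distrib power_divide)
  also have "\<dots> \<le> (1 / 2) ^ 1" using d by (intro power_decreasing) auto
  finally show ?thesis by (simp add: t_def x_def)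
qed

section \<open>Lower bound at the threshold scale\<close>

lemma strategy_contains_copy_eventually:
  fixes \<beta> :: real
  assumes H: "simple_graph H" "degenerate d H" and d: "d \<ge> 2" and \<beta>: "\<beta> > 0"
  shows "\<exists>\<delta>>0. \<forall>\<^sub>F n in sequentially. \<exists>S. valid_strategy n S \<and>
    \<delta> \<le> measure_pmf.prob
      (semi_random_graph n S (nat \<lfloor>\<beta> * real n powr ((real d - 1) / real d)\<rfloor>))
      {G. contains_copy G H}"
proof -
  define k where "k = card (verts H)"
  \<comment> \<open>There are \<open>k * d\<close> phases; the \<open>+ 1\<close> keeps
    \<open>M\<close> positive even for \<open>k = 0\<close>.\<close>
  define M where "M = k * d + 1"
  \<comment> \<open>Comes from \<open>n - k \<ge> n / 2\<close>,
    \<open>s \<ge> \<beta> * x / (2 * M)\<close> and \<open>n * x ^ d = n ^ d\<close>; it does not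
    depend on \<open>n\<close>.\<close>
  define c where "c = (\<beta> / (8 * real M)) ^ d / 2"
  define \<gamma> where "\<gamma> = (real d - 1) / real d"
  have \<gamma>: "0 < \<gamma>" "\<gamma> < 1" using d by (auto simp: \<gamma>_def)
  have M: "M > 0" by (simp add: M_def)
  have c: "c > 0" using \<beta> M by (simp add: c_def)
  \<comment> \<open>The two limits yield \<open>4 * M \<le> \<beta> * x\<close>, which absorbs
    rounding, and \<open>\<beta> * x \<le> 2 * n\<close>, which bounds the phase length.\<close>
  have "(\<lambda>n. real n powr (- \<gamma>)) \<longlonglongrightarrow> 0"
    by (rule tendsto_neg_powr[OF _ filterlim_real_sequentially]) (use \<gamma>(1) in simp)
  then have "\<forall>\<^sub>F n in sequentially. real n powr (- \<gamma>) < \<beta> / (4 * real M)"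
    by (rule order_tendstoD) (use \<beta> M in simp)
  moreover have "(\<lambda>n. real n powr (\<gamma> - 1)) \<longlonglongrightarrow> 0"
    by (rule tendsto_neg_powr[OF _ filterlim_real_sequentially]) (use \<gamma>(2) in simp)
  then have "\<forall>\<^sub>F n in sequentially. real n powr (\<gamma> - 1) < 2 / \<beta>"
    by (rule order_tendstoD) (use \<beta> in simp)
  moreover have "\<forall>\<^sub>F n in sequentially. 2 * k + 1 \<le> n" by (rule eventually_ge_at_top)
  ultimately have "\<forall>\<^sub>F n in sequentially. \<exists>S. valid_strategy n S \<and>
    ((1 - exp (- c / 5)) ^ d) ^ k \<le> measure_pmf.prob
      (semi_random_graph n S (nat \<lfloor>\<beta> * real n powr \<gamma>\<rfloor>)) {G. contains_copy G H}"
  proof eventually_elim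
    case (elim n)
    define x where "x = real n powr \<gamma>"
    define t where "t = nat \<lfloor>\<beta> * x\<rfloor>"
    define s where "s = t div M"
    have n: "n > 0" using elim(3) by simp
    have x: "4 * real M \<le> \<beta> * x" "\<beta> * x \<le> 2 * real n" "0 < x"
      using elim(1,2) n \<beta> M by (auto simp: x_def powr_diff powr_minus field_simps)
    have t: "real t \<le> \<beta> * x" "\<beta> * x - 1 \<le> real t"
      using x \<beta> by (auto simp: t_def)
    have "t < s * M + M" using M div_mult_mod_eq[of t M] mod_less_divisor[of M t] unfolding s_def by linarith
    then have "real t < real (s * M + M)" by (simp only: of_nat_less_iff)
    then have "\<beta> * x - 1 < real s * real M + real M" using t by simp
    moreover have "1 \<le> real M" using M by simp
    \<comment> \<open>Rounding loses at most \<open>1 + M \<le> 2 * M\<close>, hence at most half of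
      \<open>\<beta> * x\<close>.\<close>
    ultimately have "\<beta> * x / 2 \<le> real s * real M" using x(1) by linarith
    then have s: "\<beta> * x / (2 * real M) \<le> real s" using M by (simp add: field_simps)
    have "s \<le> t" by (simp add: s_def)
    then have s2: "s \<le> 2 * n" using t x(2) by linarith
    have "\<beta> * x / (2 * real M) / (4 * real n) = \<beta> / (8 * real M) * (x / real n)"
      by simp
    then have "real n / 2 * (\<beta> * x / (2 * real M) / (4 * real n)) ^ d
        = c * ((real n * x ^ d) / real n ^ d)"
      by (simp only: c_def power_mult_distrib power_divide[of x]) simp
    also have "real n * x ^ d = real n ^ d"
      using powr_frac_power[of d n] d n by (simp add: x_def \<gamma>_def)
    finally have "c = real n / 2 * (\<beta> * x / (2 * real M) / (4 * real n)) ^ d"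
      using n by simp
    also have "\<dots> \<le> (real n - real k) * (real s / (4 * real n)) ^ d"
      using elim(3) x(3) \<beta> s by (intro mult_mono power_mono divide_right_mono) auto
    finally have cn: "c \<le> (real n - real k) * (real s / (4 * real n)) ^ d" .
    have "k * (d * s) \<le> M * s" by (simp add: M_def)
    also have "\<dots> \<le> t" by (simp add: s_def)
    finally show ?case
      using strategy_contains_copy[OF H n s2 c] cn unfolding k_def t_def x_def by blast
  qed
  then show ?thesis
    unfolding \<gamma>_def using c by (intro exI[of _ "((1 - exp (- c / 5)) ^ d) ^ k"]) simp
qed

theorem theorem4p8:
  fixes L :: "'a ugraph list" and d :: nat
  assumes "L \<noteq> []"
    and "\<And>H. H \<in> set L \<Longrightarrow> simple_graph H \<and> \<not> forest H"
    and "d = Min (degeneracy ` set L)"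
  defines "P \<equiv> {G :: nat ugraph. \<exists>H\<in>set L. contains_copy G H}"
  shows "(\<exists>\<alpha>::real. \<alpha> > 0 \<and>
            (\<forall>\<^sub>F n in sequentially. \<forall>S. valid_strategy n S \<longrightarrow>
               measure_pmf.prob
                 (semi_random_graph n S (nat \<lfloor>\<alpha> * real n powr ((real d - 1) / real d)\<rfloor>)) P
               \<le> 1 / 2)) \<and>
         (\<forall>\<beta>::real. \<beta> > 0 \<longrightarrow> (\<exists>\<delta>::real. \<delta> > 0 \<and>
            (\<forall>\<^sub>F n in sequentially. \<exists>S. valid_strategy n S \<and>
               measure_pmf.prob
                 (semi_random_graph n S (nat \<lfloor>\<beta> * real n powr ((real d - 1) / real d)\<rfloor>)) P
               \<ge> \<delta>)))"
proof -
  have simple: "simple_graph H" "2 \<le> degeneracy H" "d \<le> degeneracy H" if "H \<in> set L" for H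
    using that assms(2,3) degeneracy_ge_2 by auto
  have "d \<in> degeneracy ` set L" unfolding assms(3) using assms(1) by (intro Min_in) auto
  \<comment> \<open>A graph attaining the minimum; the lower bound builds a copy of it, while the
    upper bound treats all of \<open>L\<close>.\<close>
  then obtain H where H: "H \<in> set L" "degeneracy H = d" by (elim imageE) simp
  have d: "d \<ge> 2" using simple(2)[OF H(1)] H(2) by simp
  define k where "k = Max ((\<lambda>H. card (verts H)) ` set L)"
  have L: "simple_graph H' \<and> \<not> degenerate (d - 1) H' \<and> card (verts H') \<le> k" if "H' \<in> set L" for H'
  proof -
    \<comment> \<open>Every graph of \<open>L\<close> has degeneracy at least \<open>d\<close>, so
      \<open>d - 1\<close> lies below its \<open>LEAST\<close>; \<open>d \<ge> 2\<close> keeps the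
      subtraction exact.\<close>
    have "d - 1 < degeneracy H'" using simple(3)[OF that] d by simp
    then have "\<not> degenerate (d - 1) H'" unfolding degeneracy_def by (rule not_less_Least)
    then show ?thesis using simple(1)[OF that] that by (simp add: k_def)
  qed
  show ?thesis
  proof (rule conjI)
    show "\<exists>\<alpha>::real. \<alpha> > 0 \<and> (\<forall>\<^sub>F n in sequentially. \<forall>S. valid_strategy n S \<longrightarrow>
        measure_pmf.prob
          (semi_random_graph n S (nat \<lfloor>\<alpha> * real n powr ((real d - 1) / real d)\<rfloor>)) P \<le> 1 / 2)"
    proof (intro exI conjI)
      show "0 < 1 / (2 * real (d ^ k\<^sup>2))" using d by simp
      show "\<forall>\<^sub>F n in sequentially. \<forall>S. valid_strategy n S \<longrightarrow>
        measure_pmf.prob (semi_random_graph n S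
          (nat \<lfloor>1 / (2 * real (d ^ k\<^sup>2)) * real n powr ((real d - 1) / real d)\<rfloor>)) P \<le> 1 / 2"
        using eventually_gt_at_top[of 0]
      proof eventually_elim
        case (elim n)
        have "d > 0" using d by simp
        then show ?case
          unfolding P_def using prob_contains_copy_le_half[OF _ elim _ L] by blast
      qed
    qed
    show "\<forall>\<beta>::real. \<beta> > 0 \<longrightarrow> (\<exists>\<delta>::real. \<delta> > 0 \<and>
        (\<forall>\<^sub>F n in sequentially. \<exists>S. valid_strategy n S \<and> measure_pmf.prob
          (semi_random_graph n S (nat \<lfloor>\<beta> * real n powr ((real d - 1) / real d)\<rfloor>)) P \<ge> \<delta>))"
    proof (intro allI impI)
      fix \<beta> :: real assume "\<beta> > 0"
      have "degenerate d H" using degenerate_degeneracy[OF simple(1)[OF H(1)]] H(2) by simp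
      then obtain \<delta> where \<delta>: "\<delta> > 0" "\<forall>\<^sub>F n in sequentially. \<exists>S. valid_strategy n S \<and>
        \<delta> \<le> measure_pmf.prob
          (semi_random_graph n S (nat \<lfloor>\<beta> * real n powr ((real d - 1) / real d)\<rfloor>))
          {G. contains_copy G H}"
        using strategy_contains_copy_eventually[OF simple(1)[OF H(1)] _ d \<open>\<beta> > 0\<close>] by blast
      have "measure_pmf.prob (M :: nat ugraph pmf) {G. contains_copy G H} \<le> measure_pmf.prob M P" for M
        using H(1) by (intro measure_pmf.finite_measure_mono) (auto simp: P_def)
      then show "\<exists>\<delta>::real. \<delta> > 0 \<and>
          (\<forall>\<^sub>F n in sequentially. \<exists>S. valid_strategy n S \<and> measure_pmf.prob
            (semi_random_graph n S (nat \<lfloor>\<beta> * real n powr ((real d - 1) / real d)\<rfloor>)) P \<ge> \<delta>)"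
        using \<delta> by (intro exI[of _ \<delta>] conjI) (auto elim!: eventually_mono intro: order.trans)
    qed
  qed
qed

end
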